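(* Let $X$ and $Y$ be binary, with $X\sim\mathrm{Bern}(p)$ and $$p_{Y|X}=\begin{bmatrix}\alpha&\beta\\ \bar\alpha&\bar\beta\end{bmatrix}$$ for some $\alpha,\beta\in[0,1]$, where $\bar\alpha=1-\alpha$, $\bar\beta=1-\beta$. Let $W$ achieve $G(X;Y)$. Then either $$p_{Y|W}=\begin{bmatrix}\alpha&1\\ \bar\alpha&0\end{bmatrix},\quad p_{W|X}=\begin{bmatrix}1&\bar\beta/\bar\alpha\\ 0&1-\bar\beta/\bar\alpha\end{bmatrix},\quad\text{and}\quad W\sim\mathrm{Bern}\big(\bar p(1-\bar\beta/\bar\alpha)\big),$$ or $$p_{Y|W}=\begin{bmatrix}0&\beta\\ 1&\bar\beta\end{bmatrix},\quad p_{W|X}=\begin{bmatrix}1-\alpha/\beta&0\\ \alpha/\beta&1\end{bmatrix},\quad\text{and}\quad W\sim\mathrm{Bern}\big(p(1-\alpha/\beta)\big),$$ where $\bar p=1-p$.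
   Context: The common entropy is $G(X;Y)=\min_{W:\,X\to W\to Y}H(W)$, where $H$ is Shannon entropy and the minimum is over all discrete $W$ jointly distributed with $(X,Y)$ (whose joint pmf is fixed) such that $X$ and $Y$ are conditionally independent given $W$ (written $X\to W\to Y$). $W$ achieves $G(X;Y)$ if $X\to W\to Y$ and $H(W)=G(X;Y)$. In a matrix $p_{B|A}$, columns are indexed by the values of $A$ and rows by the values of $B$, so each column is a conditional pmf. The value of $X$ corresponding to the first column of $p_{Y|X}$ has probability $p$ and the value corresponding to the second column has probability $\bar p$. $\mathrm{Bern}(q)$ denotes a distribution on two values with probabilities $q$ and $1-q$; for $W$, which of its two values has which probability is determined by $p_{W|X}$ and the pmf of $X$.
   Formalization: For α>β the stated matrices p_{W|X} have negative entries, so the two cases are proved as written only for α≤β; for β≤α they are proved with the two values of Y exchanged; a case whose quotient has zero denominator is excluded. *)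

theory Defs
  imports "HOL-Probability.Probability"
begin

text \<open>Entropy in bits. The value is an extended real because a discrete random variable can have
  infinite entropy; the library's real-valued \<^const>\<open>prob_space.entropy\<close> would be 0 there, which
  would spoil the minimum below. The two agree whenever the entropy is finite.\<close>

definition shannon_entropy :: "'a pmf \<Rightarrow> ennreal" where
  "shannon_entropy q = (\<integral>\<^sup>+w. ennreal (- (pmf q w * log 2 (pmf q w))) \<partial>count_space UNIV)"

lemma shannon_entropy_eq_entropy:
  fixes q :: "'a::countable pmf"
  assumes "integrable (count_space UNIV) (\<lambda>w. pmf q w * log 2 (pmf q w))"
  shows "shannon_entropy q = ennreal (prob_space.entropy (measure_pmf q) 2 (count_space UNIV) (\<lambda>w. w))"
proof -
  interpret information_space "measure_pmf q" 2
    by unfold_locales auto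
  have "distributed (measure_pmf q) (count_space UNIV) (\<lambda>w. w) (pmf q)"
    unfolding distributed_def
    by (auto simp: measure_pmf_eq_density[symmetric] distr_id2)
  then have "prob_space.entropy (measure_pmf q) 2 (count_space UNIV) (\<lambda>w. w)
      = - (\<integral>w. pmf q w * log 2 (pmf q w) \<partial>count_space UNIV)"
    by (intro entropy_distr) auto
  moreover have "0 \<le> - (pmf q w * log 2 (pmf q w))" for w
    using pmf_le_1[of q w] pmf_nonneg[of q w]
    by (cases "pmf q w = 0") (auto simp: mult_nonneg_nonpos)
  ultimately show ?thesis
    using assms unfolding shannon_entropy_def
    by (subst nn_integral_eq_integral) auto
qed

text \<open>A jointly distributed triple \<open>(X, W, Y)\<close> of discrete random variables is given by its joint
  pmf \<open>J\<close>.\<close>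

definition marg_X :: "('x \<times> 'w \<times> 'y) pmf \<Rightarrow> 'x pmf" where
  "marg_X J = map_pmf (\<lambda>(x, w, y). x) J"

definition marg_W :: "('x \<times> 'w \<times> 'y) pmf \<Rightarrow> 'w pmf" where
  "marg_W J = map_pmf (\<lambda>(x, w, y). w) J"

definition marg_XY :: "('x \<times> 'w \<times> 'y) pmf \<Rightarrow> ('x \<times> 'y) pmf" where
  "marg_XY J = map_pmf (\<lambda>(x, w, y). (x, y)) J"

definition marg_XW :: "('x \<times> 'w \<times> 'y) pmf \<Rightarrow> ('x \<times> 'w) pmf" where
  "marg_XW J = map_pmf (\<lambda>(x, w, y). (x, w)) J"

definition marg_WY :: "('x \<times> 'w \<times> 'y) pmf \<Rightarrow> ('w \<times> 'y) pmf" where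
  "marg_WY J = map_pmf (\<lambda>(x, w, y). (w, y)) J"

definition markov_chain :: "('x \<times> 'w \<times> 'y) pmf \<Rightarrow> bool" where
  "markov_chain J \<longleftrightarrow> (\<forall>w \<in> set_pmf (marg_W J). \<forall>x y.
     pmf J (x, w, y) / pmf (marg_W J) w =
     (pmf (marg_XW J) (x, w) / pmf (marg_W J) w) * (pmf (marg_WY J) (w, y) / pmf (marg_W J) w))"

text \<open>The support of a pmf is countable, so \<open>W\<close> may be taken to be valued in \<^typ>\<open>nat\<close>.\<close>

definition common_entropy :: "('x \<times> 'y) pmf \<Rightarrow> ennreal" where
  "common_entropy P =
     (INF J \<in> {J :: ('x \<times> nat \<times> 'y) pmf. marg_XY J = P \<and> markov_chain J}.
        shannon_entropy (marg_W J))"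

definition achieves_common_entropy :: "('x \<times> 'w \<times> 'y) pmf \<Rightarrow> bool" where
  "achieves_common_entropy J \<longleftrightarrow>
     markov_chain J \<and> shannon_entropy (marg_W J) = common_entropy (marg_XY J)"

text \<open>\<open>M\<close> is the matrix \<open>p\<^bsub>B|A\<^esub>\<close> for the joint pmf \<open>q\<close> of \<open>(A, B)\<close>: every column is a pmf, and the
  column of a value of \<open>A\<close> of positive probability is the conditional pmf of \<open>B\<close>. The columns of
  null values of \<open>A\<close> are otherwise arbitrary.\<close>

definition cond_matrix :: "('a::finite \<times> 'b::finite) pmf \<Rightarrow> real ^ 'a ^ 'b \<Rightarrow> bool" where
  "cond_matrix q M \<longleftrightarrow>
     (\<forall>a. (\<forall>b. 0 \<le> M $ b $ a) \<and> (\<Sum>b\<in>UNIV. M $ b $ a) = 1) \<and>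
     (\<forall>a \<in> set_pmf (map_pmf fst q). \<forall>b. M $ b $ a = pmf q (a, b) / pmf (map_pmf fst q) a)"

text \<open>The two values of \<open>X\<close> and of \<open>Y\<close> are \<open>1\<close> and \<open>2\<close>, in the order of the matrix rows and columns.
  The values of \<open>W\<close> carry no names of their own and its alphabet may contain null values. So a
  matrix description of \<open>W\<close> is understood for some labelling by \<open>1\<close> and \<open>2\<close> that is injective on the
  values of positive probability; one of the two labels may remain without probability. The vector
  \<open>r\<close> lists the probabilities of the two labels.\<close>

definition W_described_by ::
  "(2 \<times> 'w \<times> 2) pmf \<Rightarrow> real ^ 2 ^ 2 \<Rightarrow> real ^ 2 ^ 2 \<Rightarrow> real ^ 2 \<Rightarrow> bool" where
  "W_described_by J PYW PWX r \<longleftrightarrow>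
     (\<exists>l :: 'w \<Rightarrow> 2. inj_on l (set_pmf (marg_W J)) \<and>
        (let K = map_pmf (\<lambda>(x, w, y). (x, l w, y)) J
         in cond_matrix (marg_WY K) PYW \<and> cond_matrix (marg_XW K) PWX \<and>
            (\<forall>i. pmf (marg_W K) i = r $ i)))"

end

theory Submission
  imports Defs
begin

text \<open>Let \<open>D\<close> be the absolute value of the determinant of the joint pmf \<open>P\<close>, and let \<open>B \<ge> C\<close> be the two
  entries on the diagonal with the larger product. Given \<open>W = w\<close>, the joint pmf is a rank-one matrix
  lying entrywise below \<open>P\<close>, and such a matrix has total mass at most \<open>1 - t\<close> with
  \<open>t = D / B \<le> 1 / 2\<close>. A pmf all of whose atoms are at most \<open>1 - t\<close> has entropy at least the binary
  entropy of \<open>t\<close>, with equality only if its atoms are \<open>1 - t\<close> and \<open>t\<close>. The bound is attained by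
  splitting mass \<open>t\<close> off the entry \<open>C\<close>. Conversely, a rank-one matrix of mass \<open>1 - t\<close> below \<open>P\<close> must
  be \<open>P\<close> with mass \<open>t\<close> taken off \<open>C\<close>, or off \<open>B\<close> in case \<open>B = C\<close>; the second value of \<open>W\<close> is then a
  point mass on that entry.\<close>

section \<open>Binary entropy and lower bounds on Shannon entropy\<close>

definition binary_entropy :: "real \<Rightarrow> real" where
  "binary_entropy t = - (t * log 2 t) - (1 - t) * log 2 (1 - t)"

lemma binary_entropy_nonneg:
  assumes "0 \<le> t" "t \<le> 1"
  shows "0 \<le> binary_entropy t"
proof -
  have "0 \<le> - (s * log 2 s)" if "0 \<le> s" "s \<le> 1" for s :: real
    using that by (cases "s = 0") (auto simp: mult_nonneg_nonpos)
  from this[of t] this[of "1 - t"] show ?thesis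
    using assms by (simp add: binary_entropy_def)
qed

lemma binary_entropy_flip: "binary_entropy (1 - t) = binary_entropy t"
  by (simp add: binary_entropy_def)

text \<open>Gibbs' inequality on two points: the right-hand side is the cross entropy of
  \<open>t\<close> against \<open>r\<close>. Both logarithms are bounded by
  \<open>ln x \<le> x - 1\<close>, strictly for the first because \<open>r \<noteq> t\<close>, and
  the bounds add up to 0.\<close>

lemma binary_entropy_less_cross:
  assumes "0 < t" "t < 1" "0 < r" "r < 1" "r \<noteq> t"
  shows "binary_entropy t < - (t * log 2 r) - (1 - t) * log 2 (1 - r)"
proof -
  have "ln (r / t) < r / t - 1"
    using ln_le_minus_one[of "r / t"] ln_eq_minus_one[of "r / t"] assms by force
  then have "t * (ln r - ln t) < r - t"
    using assms by (simp add: ln_div field_simps)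
  moreover have "ln ((1 - r) / (1 - t)) \<le> (1 - r) / (1 - t) - 1"
    using assms by (intro ln_le_minus_one) auto
  then have "(1 - t) * (ln (1 - r) - ln (1 - t)) \<le> t - r"
    using assms by (simp add: ln_div field_simps)
  ultimately have "t * (ln r - ln t) + (1 - t) * (ln (1 - r) - ln (1 - t)) < 0"
    by linarith
  then have "(t * (ln r - ln t) + (1 - t) * (ln (1 - r) - ln (1 - t))) / ln 2 < 0"
    by (simp add: divide_neg_pos)
  then show ?thesis
    by (simp add: binary_entropy_def log_def add_divide_distrib diff_divide_distrib right_diff_distrib)
qed

lemma binary_entropy_strict_min:
  assumes "0 < t" "t < r" "r < 1 - t"
  shows "binary_entropy t < binary_entropy r"
proof -
  \<comment> \<open>The cross entropy of \<open>t\<close> against \<open>s\<close> differs from the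
    entropy of \<open>s\<close> by \<open>(s - t)\<close> times the log-odds of
    \<open>1 - s\<close>, which are nonnegative for \<open>s \<le> 1 / 2\<close>. The other half
    follows from the symmetry under \<open>r\<close> to \<open>1 - r\<close>.\<close>
  have *: "binary_entropy t < binary_entropy s" if "t < s" "s \<le> 1 / 2" for s
  proof -
    have "binary_entropy t < - (t * log 2 s) - (1 - t) * log 2 (1 - s)"
      using that assms by (intro binary_entropy_less_cross) auto
    also have "\<dots> = binary_entropy s - (s - t) * (log 2 (1 - s) - log 2 s)"
      by (simp add: binary_entropy_def algebra_simps)
    also have "\<dots> \<le> binary_entropy s"
      using that assms by simp
    finally show ?thesis .
  qed
  show ?thesis
    using *[of r] *[of "1 - r"] assms by (cases "r \<le> 1 / 2") (auto simp: binary_entropy_flip)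
qed

lemma shannon_entropy_eq_expectation:
  "shannon_entropy q = (\<integral>\<^sup>+w. ennreal (- log 2 (pmf q w)) \<partial>measure_pmf q)"
  unfolding shannon_entropy_def nn_integral_measure_pmf
  by (intro nn_integral_cong) (simp add: ennreal_mult'[symmetric])

text \<open>Entropy is the mean of \<open>- log 2 (pmf q w)\<close>, which is at least
  \<open>- log 2 s\<close> off \<open>F\<close>; the finite sum puts back the exact value on
  \<open>F\<close>. The entropy estimates below come from different choices of \<open>F\<close> and
  \<open>s\<close>.\<close>

lemma shannon_entropy_ge:
  assumes "finite F" "0 < s" "s \<le> 1" and le: "\<And>w. w \<notin> F \<Longrightarrow> pmf q w \<le> s"
  shows "ennreal (- log 2 s + (\<Sum>w\<in>F. pmf q w * (log 2 s - log 2 (pmf q w)))) \<le> shannon_entropy q"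
proof -
  \<comment> \<open>\<open>- log 2 s + v w\<close> minorizes the integrand. It takes finitely many
    values, so it is integrable even if the entropy is infinite.\<close>
  define v where "v w = (if w \<in> F then log 2 s - log 2 (pmf q w) else 0)" for w
  have "(LINT w|q. v w) = (\<Sum>w\<in>F. pmf q w * v w)"
    using \<open>finite F\<close> by (subst integral_measure_pmf[of F]) (auto simp: v_def split: if_splits)
  then have v: "(LINT w|q. v w) = (\<Sum>w\<in>F. pmf q w * (log 2 s - log 2 (pmf q w)))"
    by (simp add: v_def)
  have "finite (range v)"
    by (rule finite_subset[of _ "insert 0 ((\<lambda>w. log 2 s - log 2 (pmf q w)) ` F)"])
      (use \<open>finite F\<close> in \<open>auto simp: v_def\<close>)
  then obtain B where B: "\<And>w. \<bar>v w\<bar> \<le> B"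
    by (meson finite_imp_bounded bounded_real rangeI)
  have int: "integrable (measure_pmf q) v"
    by (rule measure_pmf.integrable_const_bound[of _ B]) (use B in auto)
  have int': "integrable (measure_pmf q) (\<lambda>w. - log 2 s + v w)"
    using int by (intro Bochner_Integration.integrable_add) auto
  have "ennreal (- log 2 s + (LINT w|q. v w)) = ennreal (LINT w|q. - log 2 s + v w)"
    using int by simp
  also have "\<dots> = (\<integral>\<^sup>+w. ennreal (- log 2 s + v w) \<partial>measure_pmf q)"
    using assms pmf_le_1[of q]
    by (intro nn_integral_eq_integral[symmetric] int')
      (auto simp: v_def AE_measure_pmf_iff set_pmf_iff pmf_pos intro!: order_less_imp_le)
  also have "\<dots> \<le> (\<integral>\<^sup>+w. ennreal (- log 2 (pmf q w)) \<partial>measure_pmf q)"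
    using assms
    by (intro nn_integral_mono_AE)
      (auto simp: v_def AE_measure_pmf_iff set_pmf_iff pmf_pos intro!: ennreal_leI)
  finally show ?thesis
    by (simp add: shannon_entropy_eq_expectation v)
qed

lemma pmf_support_pair:
  assumes "w1 \<noteq> w2" "pmf q w1 + pmf q w2 = 1"
  shows "set_pmf q \<subseteq> {w1, w2}"
proof
  fix w assume w: "w \<in> set_pmf q"
  show "w \<in> {w1, w2}"
  proof (rule ccontr)
    assume "w \<notin> {w1, w2}"
    then have "sum (pmf q) {w, w1, w2} = pmf q w + 1"
      using assms by simp
    moreover have "sum (pmf q) {w, w1, w2} \<le> 1"
      by (metis finite.intros measure_measure_pmf_finite measure_pmf.prob_le_1)
    ultimately have "pmf q w \<le> 0" by simp
    with w show False
      by (metis pmf_positive not_le)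
  qed
qed

lemma pmf_le_compl:
  assumes "w \<noteq> w'"
  shows "pmf q w \<le> 1 - pmf q w'"
proof -
  have "sum (pmf q) {w, w'} \<le> 1"
    by (metis finite.intros measure_measure_pmf_finite measure_pmf.prob_le_1)
  then show ?thesis
    using assms by simp
qed

text \<open>Merging all values other than \<open>w0\<close> cannot raise the entropy: each of the
  other atoms has at most the complementary mass, which serves as \<open>s\<close>.\<close>

lemma shannon_entropy_ge_binary_entropy:
  assumes "pmf q w0 < 1"
  shows "ennreal (binary_entropy (pmf q w0)) \<le> shannon_entropy q"
proof -
  define s where "s = 1 - pmf q w0"
  have "ennreal (- log 2 s + (\<Sum>w\<in>{w0}. pmf q w * (log 2 s - log 2 (pmf q w)))) \<le> shannon_entropy q"
    using assms by (intro shannon_entropy_ge) (auto simp: s_def intro: pmf_le_compl)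
  then show ?thesis
    by (simp add: binary_entropy_def s_def algebra_simps)
qed

text \<open>The equality case of the merging bound. With a further value \<open>w2\<close> of the
  support in \<open>F\<close>, the bound gains a positive term unless \<open>w2\<close> carries all
  the remaining mass.\<close>

lemma second_atom_of_entropy_le:
  assumes le: "shannon_entropy q \<le> ennreal (binary_entropy (pmf q w1))"
    and r: "0 < pmf q w1" "pmf q w1 < 1"
  shows "\<exists>w2. w2 \<noteq> w1 \<and> pmf q w2 = 1 - pmf q w1"
proof -
  define s where "s = 1 - pmf q w1"
  have "set_pmf q \<noteq> {w1}"
  proof
    assume "set_pmf q = {w1}"
    then have "q = return_pmf w1"
      using set_pmf_subset_singleton by fastforce
    then show False using r by simp
  qed
  then obtain w2 where w2: "w2 \<in> set_pmf q" "w2 \<noteq> w1"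
    using set_pmf_not_empty[of q] by blast
  have s: "0 < s" "s \<le> 1" using r by (auto simp: s_def)
  have "ennreal (- log 2 s + (\<Sum>w\<in>{w1, w2}. pmf q w * (log 2 s - log 2 (pmf q w)))) \<le> shannon_entropy q"
    using s by (intro shannon_entropy_ge) (auto simp: s_def intro: pmf_le_compl)
  also note le
  finally have "- log 2 s + (\<Sum>w\<in>{w1, w2}. pmf q w * (log 2 s - log 2 (pmf q w))) \<le> binary_entropy (pmf q w1)"
    using r binary_entropy_nonneg[of "pmf q w1"] by (subst (asm) ennreal_le_iff) auto
  \<comment> \<open>\<open>- log 2 s\<close> and the term of \<open>w1\<close> add up to exactly the
    binary entropy, so the term of \<open>w2\<close> cannot be positive.\<close>
  then have "pmf q w2 * (log 2 s - log 2 (pmf q w2)) \<le> 0"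
    using w2 by (simp add: binary_entropy_def s_def algebra_simps)
  moreover have "0 < pmf q w2"
    using w2 by (simp add: pmf_positive)
  ultimately have "s \<le> pmf q w2"
    using s by (simp add: mult_le_0_iff)
  moreover have "pmf q w2 \<le> s"
    using w2 by (simp add: s_def pmf_le_compl)
  ultimately show ?thesis
    using w2 by (auto simp: s_def)
qed

text \<open>Some atom has mass at least \<open>t\<close>, hence mass between \<open>t\<close> and
  \<open>1 - t\<close>. Merging the rest and strict minimality at the ends of this interval force
  the mass to be \<open>t\<close> or \<open>1 - t\<close>; the equality case then supplies the
  complementary atom.\<close>

lemma atoms_of_entropy_le_binary_entropy:
  assumes H: "shannon_entropy q \<le> ennreal (binary_entropy t)"
    and t: "0 \<le> t" "t \<le> 1 / 2" and le: "\<And>w. pmf q w \<le> 1 - t"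
  obtains w1 w2 where "pmf q w1 = 1 - t" "set_pmf q \<subseteq> {w1, w2}"
proof -
  have *: "x \<le> binary_entropy t" if "ennreal x \<le> shannon_entropy q" for x
    using order_trans[OF that H] t binary_entropy_nonneg[of t] by (subst (asm) ennreal_le_iff) auto
  obtain w0 where w0: "w0 \<in> set_pmf q"
    using set_pmf_not_empty[of q] by blast
  then have w0_pos: "0 < pmf q w0"
    by (simp add: pmf_positive)
  show ?thesis
  proof (cases "t = 0")
    \<comment> \<open>The entropy is 0 here, so \<open>q\<close> is a point mass and
      \<open>w0\<close> serves as both values.\<close>
    case True
    have "ennreal (- log 2 1 + (\<Sum>w\<in>{w0}. pmf q w * (log 2 1 - log 2 (pmf q w)))) \<le> shannon_entropy q"
      by (rule shannon_entropy_ge) (auto simp: pmf_le_1)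
    from *[OF this] have "0 \<le> pmf q w0 * log 2 (pmf q w0)"
      by (simp add: True binary_entropy_def)
    then have "1 \<le> pmf q w0"
      using w0_pos by (simp add: zero_le_mult_iff)
    then have one: "pmf q w0 = 1"
      using pmf_le_1[of q w0] by linarith
    have "set_pmf q \<subseteq> {w0}"
      using pmf_le_compl[of _ w0 q] by (force simp: one dest: pmf_positive)
    with one show ?thesis
      using True that[of w0 w0] by simp
  next
    case False
    then have t0: "0 < t" using t by simp
    \<comment> \<open>If all atoms were below \<open>t\<close>, the entropy would strictly exceed
      \<open>- log 2 t\<close>, which is at least the binary entropy of \<open>t\<close> because
      \<open>t \<le> 1 / 2\<close>.\<close>
    have "\<exists>w. t \<le> pmf q w"
    proof (rule ccontr)
      assume "\<not> ?thesis"
      then have lt: "pmf q w < t" for w by (meson not_le)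
      have "ennreal (- log 2 t + (\<Sum>w\<in>{w0}. pmf q w * (log 2 t - log 2 (pmf q w)))) \<le> shannon_entropy q"
        using t t0 by (intro shannon_entropy_ge) (auto intro: less_imp_le[OF lt])
      from *[OF this] have "- log 2 t + pmf q w0 * (log 2 t - log 2 (pmf q w0)) \<le> binary_entropy t"
        by simp
      moreover have "0 < pmf q w0 * (log 2 t - log 2 (pmf q w0))"
        using lt[of w0] w0_pos by simp
      moreover have "binary_entropy t = - log 2 t - (1 - t) * (log 2 (1 - t) - log 2 t)"
        by (simp add: binary_entropy_def algebra_simps)
      moreover have "0 \<le> (1 - t) * (log 2 (1 - t) - log 2 t)"
        using t t0 by (intro mult_nonneg_nonneg) auto
      ultimately show False by linarith
    qed
    then obtain w1 where w1: "t \<le> pmf q w1" by blast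
    have bounds: "0 < pmf q w1" "pmf q w1 < 1"
      using w1 t0 le[of w1] by auto
    have "\<not> binary_entropy t < binary_entropy (pmf q w1)"
      using *[OF shannon_entropy_ge_binary_entropy[of q w1]] bounds by simp
    then have "pmf q w1 = t \<or> pmf q w1 = 1 - t"
      using binary_entropy_strict_min[OF t0, of "pmf q w1"] w1 le[of w1] by force
    then have "binary_entropy (pmf q w1) = binary_entropy t"
      by (auto simp: binary_entropy_flip)
    with H second_atom_of_entropy_le[of q w1] bounds
    obtain w2 where w2: "w2 \<noteq> w1" "pmf q w2 = 1 - pmf q w1" by auto
    then have sub: "set_pmf q \<subseteq> {w1, w2}"
      by (intro pmf_support_pair) auto
    from \<open>pmf q w1 = t \<or> pmf q w1 = 1 - t\<close> show ?thesis
    proof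
      assume "pmf q w1 = t"
      then show ?thesis using w2 sub that[of w2 w1] by auto
    next
      assume "pmf q w1 = 1 - t"
      then show ?thesis using sub that by blast
    qed
  qed
qed


section \<open>Marginals, conditional matrices and the Markov condition for binary variables\<close>

lemma UNIV_2_eq: "x0 \<noteq> x1 \<Longrightarrow> UNIV = {x0, x1 :: 2}"
  by (metis (mono_tags) UNIV_2 doubleton_eq_iff exhaust_2)

lemma sum_UNIV_2_eq:
  fixes f :: "2 \<Rightarrow> 'a::comm_monoid_add"
  shows "x0 \<noteq> x1 \<Longrightarrow> sum f UNIV = f x0 + f x1"
  by (subst UNIV_2_eq[of x0 x1]) auto

lemma all_2_eq: "x0 \<noteq> x1 \<Longrightarrow> (\<forall>x::2. Q x) \<longleftrightarrow> Q x0 \<and> Q x1"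
  using UNIV_2_eq[of x0 x1] by (metis UNIV_I insert_iff singletonD)

lemma all_2_2:
  assumes "x0 \<noteq> x1" "y0 \<noteq> y1"
  shows "(\<forall>x y::2. Q x y) \<longleftrightarrow> Q (x0::2) y0 \<and> Q x0 y1 \<and> Q x1 y0 \<and> Q x1 y1"
  using all_2_eq[OF assms(1), of "\<lambda>x. \<forall>y. Q x y"] all_2_eq[OF assms(2), of "Q x0"]
    all_2_eq[OF assms(2), of "Q x1"] by blast

lemma pmf_map_eq_sum:
  assumes "finite A" "f -` {z} = A"
  shows "pmf (map_pmf f p) z = sum (pmf p) A"
  using assms by (simp add: pmf_map measure_measure_pmf_finite)

lemma pmf_marg_XW:
  fixes J :: "('x \<times> 'w \<times> 'y::finite) pmf"
  shows "pmf (marg_XW J) (x, w) = (\<Sum>y\<in>UNIV. pmf J (x, w, y))"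
  unfolding marg_XW_def
  by (subst pmf_map_eq_sum[of "(\<lambda>y. (x, w, y)) ` UNIV"]) (auto simp: sum.reindex inj_on_def)

lemma pmf_marg_WY:
  fixes J :: "('x::finite \<times> 'w \<times> 'y) pmf"
  shows "pmf (marg_WY J) (w, y) = (\<Sum>x\<in>UNIV. pmf J (x, w, y))"
  unfolding marg_WY_def
  by (subst pmf_map_eq_sum[of "(\<lambda>x. (x, w, y)) ` UNIV"]) (auto simp: sum.reindex inj_on_def)

lemma pmf_marg_XY:
  fixes J :: "('x \<times> 'w::finite \<times> 'y) pmf"
  shows "pmf (marg_XY J) (x, y) = (\<Sum>w\<in>UNIV. pmf J (x, w, y))"
  unfolding marg_XY_def
  by (subst pmf_map_eq_sum[of "(\<lambda>w. (x, w, y)) ` UNIV"]) (auto simp: sum.reindex inj_on_def)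

lemma map_fst_marg:
  "map_pmf fst (marg_XY J) = marg_X J"
  "map_pmf fst (marg_XW J) = marg_X J"
  "map_pmf fst (marg_WY J) = marg_W J"
  unfolding marg_XY_def marg_XW_def marg_WY_def marg_X_def marg_W_def pmf.map_comp
  by (auto intro!: map_pmf_cong)

lemma pmf_map_fst:
  fixes q :: "('a \<times> 'b::finite) pmf"
  shows "pmf (map_pmf fst q) a = (\<Sum>b\<in>UNIV. pmf q (a, b))"
  by (subst pmf_map_eq_sum[of "Pair a ` UNIV"]) (auto simp: sum.reindex inj_on_def)

lemma pmf_marg_W:
  fixes J :: "('x::finite \<times> 'w \<times> 'y::finite) pmf"
  shows "pmf (marg_W J) w = (\<Sum>x\<in>UNIV. \<Sum>y\<in>UNIV. pmf J (x, w, y))"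
  unfolding map_fst_marg[symmetric] pmf_map_fst pmf_marg_WY by (rule sum.swap)

lemma pmf_marg_2:
  fixes J :: "(2 \<times> 'w \<times> 2) pmf"
  assumes "x0 \<noteq> x1" "y0 \<noteq> y1"
  shows "pmf (marg_XW J) (x, w) = pmf J (x, w, y0) + pmf J (x, w, y1)"
    and "pmf (marg_WY J) (w, y) = pmf J (x0, w, y) + pmf J (x1, w, y)"
    and "pmf (marg_W J) w =
      pmf J (x0, w, y0) + pmf J (x0, w, y1) + pmf J (x1, w, y0) + pmf J (x1, w, y1)"
proof -
  show XW: "pmf (marg_XW J) (x, w) = pmf J (x, w, y0) + pmf J (x, w, y1)" for x
    unfolding pmf_marg_XW by (rule sum_UNIV_2_eq[OF assms(2)])
  show "pmf (marg_WY J) (w, y) = pmf J (x0, w, y) + pmf J (x1, w, y)"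
    unfolding pmf_marg_WY by (rule sum_UNIV_2_eq[OF assms(1)])
  show "pmf (marg_W J) w =
      pmf J (x0, w, y0) + pmf J (x0, w, y1) + pmf J (x1, w, y0) + pmf J (x1, w, y1)"
    unfolding pmf_marg_W pmf_marg_XW[symmetric] XW sum_UNIV_2_eq[OF assms(1)] by simp
qed

lemma pmf_le_pmf_marg_XY: "pmf J (x, w, y) \<le> pmf (marg_XY J) (x, y)"
  unfolding marg_XY_def
  by (subst pmf_map, subst measure_pmf_single[symmetric])
    (auto intro!: measure_pmf.finite_measure_mono)

text \<open>The product form needs neither division nor a case distinction on the support, since
  both sides of the equation vanish at null values.\<close>

lemma cond_matrix_iff:
  "cond_matrix q M \<longleftrightarrow>
     (\<forall>a. (\<forall>b. 0 \<le> M $ b $ a) \<and> (\<Sum>b\<in>UNIV. M $ b $ a) = 1) \<and>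
     (\<forall>a b. pmf q (a, b) = pmf (map_pmf fst q) a * M $ b $ a)"
proof -
  have "(a \<in> set_pmf (map_pmf fst q) \<longrightarrow> (\<forall>b. M $ b $ a = pmf q (a, b) / pmf (map_pmf fst q) a)) \<longleftrightarrow>
      (\<forall>b. pmf q (a, b) = pmf (map_pmf fst q) a * M $ b $ a)" for a
  proof (cases "a \<in> set_pmf (map_pmf fst q)")
    case True
    then have "pmf (map_pmf fst q) a \<noteq> 0"
      by (simp only: set_pmf_iff not_False_eq_True)
    then have "M $ b $ a = pmf q (a, b) / pmf (map_pmf fst q) a \<longleftrightarrow>
        pmf q (a, b) = pmf (map_pmf fst q) a * M $ b $ a" for b
      by (auto simp: field_simps)
    with True show ?thesis
      by (simp only: simp_thms)
  next
    case False
    then have "pmf q (a, b) = 0" for b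
      by (force simp: pmf_eq_0_set_pmf)
    moreover from False have "pmf (map_pmf fst q) a = 0"
      by (simp only: set_pmf_iff not_not)
    ultimately show ?thesis
      using False by simp
  qed
  then show ?thesis
    unfolding cond_matrix_def by (metis (no_types, lifting))
qed

text \<open>Given \<open>w\<close>, two binary variables are independent exactly if their joint
  matrix has rank at most one. For null \<open>w\<close> the slice is zero and so is its
  determinant.\<close>

lemma markov_chain_iff_det:
  fixes J :: "(2 \<times> 'w \<times> 2) pmf"
  assumes "x0 \<noteq> x1" "y0 \<noteq> y1"
  shows "markov_chain J \<longleftrightarrow>
    (\<forall>w. pmf J (x0, w, y0) * pmf J (x1, w, y1) = pmf J (x1, w, y0) * pmf J (x0, w, y1))"
proof -
  note marg = pmf_marg_2[OF assms, of J]
  have "(w \<in> set_pmf (marg_W J) \<longrightarrow> (\<forall>x y. pmf J (x, w, y) / pmf (marg_W J) w =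
        (pmf (marg_XW J) (x, w) / pmf (marg_W J) w) * (pmf (marg_WY J) (w, y) / pmf (marg_W J) w))) \<longleftrightarrow>
      pmf J (x0, w, y0) * pmf J (x1, w, y1) = pmf J (x1, w, y0) * pmf J (x0, w, y1)" for w
  proof (cases "w \<in> set_pmf (marg_W J)")
    case True
    define a b c d where "a = pmf J (x0, w, y0)" "b = pmf J (x0, w, y1)"
      "c = pmf J (x1, w, y0)" "d = pmf J (x1, w, y1)"
    note abcd = a_b_c_d_def[symmetric]
    have r: "pmf (marg_W J) w = a + b + c + d"
      by (simp add: marg abcd)
    have r0: "a + b + c + d \<noteq> 0"
      using True by (simp add: set_pmf_iff r)
    \<comment> \<open>After the slice mass is cleared from the denominators, each of the four cell
      equations expands to the vanishing of the same determinant.\<close>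
    have *: "z / (a + b + c + d) = u / (a + b + c + d) * (v / (a + b + c + d)) \<longleftrightarrow>
        z * (a + b + c + d) = u * v" for z u v
      using r0 by (simp add: divide_simps)
    show ?thesis
      unfolding all_2_2[OF assms] r marg abcd * using True by (auto simp: algebra_simps)
  next
    case False
    then have "pmf J (x, w, y) = 0" for x y
      by (force simp: pmf_eq_0_set_pmf marg_W_def)
    with False show ?thesis by simp
  qed
  then show ?thesis
    unfolding markov_chain_def by (metis (no_types, lifting))
qed

section \<open>Upper bound on the common entropy\<close>

lemma pmf_bind_map_insert:
  "pmf (bind_pmf P (\<lambda>(x, y). map_pmf (\<lambda>w. (x, w, y)) (k x y))) (x, w, y) = pmf P (x, y) * pmf (k x y) w"
proof -
  have "pmf (map_pmf (\<lambda>w. (x', w, y')) (k x' y')) (x, w, y) = (if (x', y') = (x, y) then pmf (k x y) w else 0)" for x' y'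
  proof (cases "(x', y') = (x, y)")
    case True
    have "inj (\<lambda>w. (x, w, y))" by (auto simp: inj_on_def)
    from pmf_map_inj'[OF this] True show ?thesis by simp
  next
    case False
    then show ?thesis by (auto simp: pmf_eq_0_set_pmf)
  qed
  then show ?thesis
    unfolding pmf_bind by (subst integral_measure_pmf_real[of "{(x, y)}"]) (auto split: if_splits)
qed

lemma sum_pmf_2:
  fixes P :: "(2 \<times> 2) pmf"
  assumes "x0 \<noteq> x1" "y0 \<noteq> y1"
  shows "pmf P (x0, y0) + pmf P (x0, y1) + pmf P (x1, y0) + pmf P (x1, y1) = 1"
proof -
  have "(\<Sum>x\<in>UNIV. \<Sum>y\<in>UNIV. pmf P (x, y)) = 1"
    using sum_pmf_eq_1[of UNIV P] by (simp add: sum.cartesian_product)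
  moreover have "(\<Sum>y\<in>UNIV. pmf P (x, y)) = pmf P (x, y0) + pmf P (x, y1)" for x
    by (rule sum_UNIV_2_eq[OF assms(2)])
  ultimately show ?thesis
    by (simp add: sum_UNIV_2_eq[OF assms(1)])
qed

text \<open>The witness sets \<open>W = 1\<close> on mass \<open>t\<close> of the cell
  \<open>(x0, y0)\<close> and \<open>W = 0\<close> elsewhere. The slice at 1 is a single cell, hence
  of rank at most one; \<open>det\<close> says the same of the slice at 0.\<close>

lemma common_entropy_le_binary_entropy:
  fixes P :: "(2 \<times> 2) pmf"
  assumes xy: "x0 \<noteq> x1" "y0 \<noteq> y1"
    and t: "0 \<le> t" "t \<le> pmf P (x0, y0)"
    and det: "(pmf P (x0, y0) - t) * pmf P (x1, y1) = pmf P (x1, y0) * pmf P (x0, y1)"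
  shows "common_entropy P \<le> ennreal (binary_entropy t)"
proof -
  \<comment> \<open>\<open>c\<close> is the probability of \<open>W = 1\<close> given the cell
    \<open>(x0, y0)\<close>. If that cell is null, then \<open>t = 0\<close> and division by zero
    gives \<open>c = 0\<close>.\<close>
  define c where "c = t / pmf P (x0, y0)"
  have c: "0 \<le> c" "c \<le> 1" "pmf P (x0, y0) * c = t" "pmf P (x0, y0) * (1 - c) = pmf P (x0, y0) - t"
    using t by (auto simp: c_def divide_simps)
  define k :: "2 \<Rightarrow> 2 \<Rightarrow> nat pmf" where
    "k x y = (if x = x0 \<and> y = y0 then map_pmf of_bool (bernoulli_pmf c) else return_pmf 0)" for x y
  define J where "J = bind_pmf P (\<lambda>(x, y). map_pmf (\<lambda>w. (x, w, y)) (k x y))"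
  have inj: "inj (of_bool :: bool \<Rightarrow> nat)" by (auto simp: inj_on_def)
  have k: "pmf (k x0 y0) 0 = 1 - c" "pmf (k x0 y0) 1 = c" 
    using pmf_map_inj'[OF inj, of "bernoulli_pmf c" False] pmf_map_inj'[OF inj, of "bernoulli_pmf c" True] c
    by (simp_all add: k_def)
  have k2: "pmf (k x y) w = 0" if "w \<notin> {0, 1}" for x y w
    using that by (auto simp: k_def pmf_eq_0_set_pmf)
  have k0: "pmf (k x y) w = (if w = 0 then 1 else 0)" if "(x, y) \<noteq> (x0, y0)" for x y w
    using that by (auto simp: k_def)
  have J: "pmf J (x, w, y) = pmf P (x, y) * pmf (k x y) w" for x w y
    unfolding J_def by (rule pmf_bind_map_insert)
  have "marg_XY J = P"
    by (simp add: J_def marg_XY_def map_bind_pmf pmf.map_comp comp_def case_prod_beta' map_pmf_const bind_return_pmf')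
  moreover have "markov_chain J"
  proof (unfold markov_chain_iff_det[OF xy], intro allI)
    fix w :: nat
    consider "w = 0" | "w = 1" | "w \<notin> {0, 1}" by auto
    then show "pmf J (x0, w, y0) * pmf J (x1, w, y1) = pmf J (x1, w, y0) * pmf J (x0, w, y1)"
      using xy det by cases (auto simp: J k k0 k2 c(4))
  qed
  moreover have "shannon_entropy (marg_W J) = ennreal (binary_entropy t)"
  proof -
    have "pmf (marg_W J) 1 = t"
      using xy by (simp add: pmf_marg_2[OF xy] J k0 c k[unfolded One_nat_def])
    moreover have "pmf (marg_W J) 0 = 1 - t"
    proof -
      note sum_pmf_2[OF xy, of P]
      then show ?thesis
        using xy by (simp add: pmf_marg_2[OF xy] J k k0 c)
    qed
    moreover have "pmf (marg_W J) w = 0" if "w \<notin> {0, 1}" for w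
      using that by (simp add: pmf_marg_W J k2)
    moreover have "t \<le> 1" using t pmf_le_1[of P] order_trans by blast
    then have "0 \<le> - (t * log 2 t)" "0 \<le> - ((1 - t) * log 2 (1 - t))"
      using t by (cases "t = 0"; cases "t = 1"; auto simp: mult_nonneg_nonpos)+
    ultimately show ?thesis
      unfolding shannon_entropy_def
      by (subst nn_integral_count_space'[of "{0, 1}"])
        (auto simp: binary_entropy_def ennreal_plus[symmetric] simp del: ennreal_plus)
  qed
  ultimately show ?thesis
    unfolding common_entropy_def by (metis (mono_tags, lifting) INF_lower mem_Collect_eq)
qed

section \<open>Mass of a rank-one matrix below a given matrix\<close>

lemma rank_one_mass_bound:
  fixes a b c d A B C D :: real
  assumes nonneg: "0 \<le> a" "0 \<le> b" "0 \<le> c" "0 \<le> d"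
    and le: "a \<le> A" "b \<le> B" "c \<le> C" "d \<le> D"
    and det: "b * c = a * d" and "A * D \<le> B * C" "C \<le> B"
  shows "a + b + c + d \<le> A + B + C + D - (C - A * D / B)"
    and "a + b + c + d = A + B + C + D - (C - A * D / B) \<Longrightarrow>
      a = A \<and> d = D \<and> (b = B \<and> c = A * D / B \<or> c = C \<and> b = A * D / C \<and> B = C)"
proof -
  have ad: "a * d \<le> A * D"
    using le nonneg by (intro mult_mono) auto
  have "a + b + c + d \<le> A + B + C + D - (C - A * D / B) \<and>
    (a + b + c + d = A + B + C + D - (C - A * D / B) \<longrightarrow>
      a = A \<and> d = D \<and> (b = B \<and> c = A * D / B \<or> c = C \<and> b = A * D / C \<and> B = C))"
  proof (cases "B = 0")
    \<comment> \<open>Here \<open>C\<close>, \<open>b\<close>, \<open>c\<close> and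
      \<open>A * D\<close> vanish too, and division by zero makes the subtracted mass 0.\<close>
    case True
    then show ?thesis using assms by auto
  next
    case False
    then have B: "0 < B" using le nonneg by linarith
    \<comment> \<open>\<open>L\<close> is the slack in the bound, written by means of
      \<open>b * c = a * d\<close> as a sum of four nonnegative terms. Equality makes each of them
      vanish, and the last one gives \<open>b = B\<close> or \<open>c = B\<close>.\<close>
    define L where "L = (A - a) + (D - d) + (A * D - a * d) / B + (B - b) * (B - c) / B"
    have L: "A + B + C + D - (C - A * D / B) - (a + b + c + d) = L"
      using B det by (simp add: L_def field_simps)
    have parts: "0 \<le> A - a" "0 \<le> D - d" "0 \<le> (A * D - a * d) / B" "0 \<le> (B - b) * (B - c) / B"
      using ad B le \<open>C \<le> B\<close> by auto
    have "a = A \<and> d = D \<and> (b = B \<and> c = A * D / B \<or> c = C \<and> b = A * D / C \<and> B = C)" if "L = 0"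
    proof -
      have "a = A" "d = D" "(B - b) * (B - c) / B = 0"
        using parts that unfolding L_def by linarith+
      then have "b = B \<or> c = B" using B by auto
      then show ?thesis
      proof
        assume "b = B"
        then show ?thesis using \<open>a = A\<close> \<open>d = D\<close> det B by (auto simp: field_simps)
      next
        assume "c = B"
        then have "c = C" "B = C" using le \<open>C \<le> B\<close> by auto
        then show ?thesis using \<open>a = A\<close> \<open>d = D\<close> det B by (auto simp: field_simps)
      qed
    qed
    moreover have "0 \<le> L"
      using parts by (simp add: L_def)
    ultimately show ?thesis
      using L by (smt (verit))
  qed
  then show "a + b + c + d \<le> A + B + C + D - (C - A * D / B)"
    and "a + b + c + d = A + B + C + D - (C - A * D / B) \<Longrightarrow>
      a = A \<and> d = D \<and> (b = B \<and> c = A * D / B \<or> c = C \<and> b = A * D / C \<and> B = C)"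
    by auto
qed


section \<open>Structure of an achieving W\<close>

text \<open>The joint pmf restricted to \<open>W = w\<close> is that of \<open>(X, Y)\<close> with mass \<open>t\<close> taken off the cell
  \<open>(x0, y0)\<close>, and \<open>excess\<close> is the mass whose removal from that cell makes the determinant vanish.\<close>

definition peels_off :: "(2 \<times> 'w \<times> 2) pmf \<Rightarrow> 'w \<Rightarrow> 2 \<Rightarrow> 2 \<Rightarrow> real \<Rightarrow> bool" where
  "peels_off J w x0 y0 t \<longleftrightarrow>
    (\<forall>x y. pmf J (x, w, y) = pmf (marg_XY J) (x, y) - (if x = x0 \<and> y = y0 then t else 0))"

definition excess :: "(2 \<times> 2) pmf \<Rightarrow> 2 \<Rightarrow> 2 \<Rightarrow> 2 \<Rightarrow> 2 \<Rightarrow> real" where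
  "excess P x0 x1 y0 y1 =
    pmf P (x0, y0) - pmf P (x1, y0) * pmf P (x0, y1) / pmf P (x1, y1)"

text \<open>The rank-one bound limits every atom of \<open>W\<close> to \<open>1 - t\<close>, and
  the construction above limits its entropy to the binary entropy of \<open>t\<close>. So some atom
  equals \<open>1 - t\<close>, and the equality case of the rank-one bound determines its slice. The
  second alternative occurs only at a tie of the diagonal cells.\<close>

lemma achiever_peels_off_smaller:
  fixes J :: "(2 \<times> 'w \<times> 2) pmf"
  assumes xy: "x0 \<noteq> x1" "y0 \<noteq> y1"
    and ach: "achieves_common_entropy J"
  defines "P \<equiv> marg_XY J"
  assumes det: "pmf P (x1, y0) * pmf P (x0, y1) \<le> pmf P (x0, y0) * pmf P (x1, y1)"
    and le: "pmf P (x0, y0) \<le> pmf P (x1, y1)"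
  shows "\<exists>w1 w2. set_pmf (marg_W J) \<subseteq> {w1, w2} \<and>
    (peels_off J w1 x0 y0 (excess P x0 x1 y0 y1) \<or>
     peels_off J w1 x1 y1 (excess P x1 x0 y1 y0) \<and> pmf P (x0, y0) = pmf P (x1, y1))"
proof -
  define t where "t = excess P x0 x1 y0 y1"
  \<comment> \<open>This covers the degenerate case of \<open>excess\<close>, whose quotient is 0 by
    convention when the larger diagonal cell is null.\<close>
  have off_0: "pmf P (x1, y0) * pmf P (x0, y1) = 0" if "pmf P (x1, y1) = 0"
    using det that mult_nonneg_nonneg[OF pmf_nonneg pmf_nonneg, of P "(x1, y0)" P "(x0, y1)"]
    by simp
  have t1: "0 \<le> t"
    using det le pmf_nonneg[of P "(x1, y1)"]
    by (cases "pmf P (x1, y1) = 0") (auto simp: t_def excess_def divide_simps)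
  have t2: "t \<le> pmf P (x0, y0)"
    by (simp add: t_def excess_def)
  have t3: "(pmf P (x0, y0) - t) * pmf P (x1, y1) = pmf P (x1, y0) * pmf P (x0, y1)"
    using off_0 by (cases "pmf P (x1, y1) = 0") (auto simp: t_def excess_def)
  note t = t1 t2 t3
  have one: "pmf P (x0, y0) + pmf P (x0, y1) + pmf P (x1, y0) + pmf P (x1, y1) = 1"
    by (rule sum_pmf_2[OF xy])
  then have t_half: "t \<le> 1 / 2"
    using t(2) le pmf_nonneg[of P "(x0, y1)"] pmf_nonneg[of P "(x1, y0)"] by linarith
  have markov: "markov_chain J" and H: "shannon_entropy (marg_W J) \<le> ennreal (binary_entropy t)"
    using ach common_entropy_le_binary_entropy[OF xy t]
    by (auto simp: achieves_common_entropy_def P_def)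
  have det_w: "pmf J (x1, w, y1) * pmf J (x0, w, y0) = pmf J (x0, w, y1) * pmf J (x1, w, y0)" for w
    using markov markov_chain_iff_det[OF xy, of J] by (simp add: mult.commute)
  have det': "pmf P (x0, y1) * pmf P (x1, y0) \<le> pmf P (x1, y1) * pmf P (x0, y0)"
    using det by (simp add: mult.commute)
  have le_P: "pmf J (x, w, y) \<le> pmf P (x, y)" for x w y
    unfolding P_def by (rule pmf_le_pmf_marg_XY)
  \<comment> \<open>The off-diagonal cells take the places of \<open>A\<close> and \<open>D\<close>,
    the larger diagonal cell that of \<open>B\<close>, the smaller that of \<open>C\<close>.\<close>
  note bound = rank_one_mass_bound
    [of "pmf J (x0, w, y1)" "pmf J (x1, w, y1)" "pmf J (x0, w, y0)" "pmf J (x1, w, y0)" for w,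
      OF pmf_nonneg pmf_nonneg pmf_nonneg pmf_nonneg le_P le_P le_P le_P det_w det' le]
  have t_eq: "t = pmf P (x0, y0) - pmf P (x0, y1) * pmf P (x1, y0) / pmf P (x1, y1)"
    by (simp add: t_def excess_def mult.commute)
  have W: "pmf (marg_W J) w = pmf J (x0, w, y1) + pmf J (x1, w, y1) + pmf J (x0, w, y0) + pmf J (x1, w, y0)" for w
    by (simp add: pmf_marg_2(3)[OF xy])
  have "pmf (marg_W J) w \<le> 1 - t" for w
    using bound(1)[of w] one unfolding W t_eq by linarith
  from atoms_of_entropy_le_binary_entropy[OF H t(1) t_half this]
  obtain w1 w2 where w: "pmf (marg_W J) w1 = 1 - t" "set_pmf (marg_W J) \<subseteq> {w1, w2}"
    by blast
  have "pmf J (x0, w1, y1) + pmf J (x1, w1, y1) + pmf J (x0, w1, y0) + pmf J (x1, w1, y0) =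
      pmf P (x0, y1) + pmf P (x1, y1) + pmf P (x0, y0) + pmf P (x1, y0) -
      (pmf P (x0, y0) - pmf P (x0, y1) * pmf P (x1, y0) / pmf P (x1, y1))"
    using w(1) one unfolding W t_eq by linarith
  note extremal = bound(2)[OF this]
  then have diag: "pmf J (x0, w1, y1) = pmf P (x0, y1)" "pmf J (x1, w1, y0) = pmf P (x1, y0)"
    by blast+
  from extremal consider
      "pmf J (x1, w1, y1) = pmf P (x1, y1)"
      "pmf J (x0, w1, y0) = pmf P (x0, y1) * pmf P (x1, y0) / pmf P (x1, y1)"
    | "pmf J (x0, w1, y0) = pmf P (x0, y0)"
      "pmf J (x1, w1, y1) = pmf P (x0, y1) * pmf P (x1, y0) / pmf P (x0, y0)"
      "pmf P (x1, y1) = pmf P (x0, y0)"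
    by blast
  then have "peels_off J w1 x0 y0 t \<or>
     peels_off J w1 x1 y1 (excess P x1 x0 y1 y0) \<and> pmf P (x0, y0) = pmf P (x1, y1)"
  proof cases
    case 1
    then have "peels_off J w1 x0 y0 t"
      unfolding peels_off_def all_2_2[OF xy] P_def[symmetric] using diag xy by (simp add: t_eq)
    then show ?thesis ..
  next
    case 2
    then have "peels_off J w1 x1 y1 (excess P x1 x0 y1 y0)"
      unfolding peels_off_def all_2_2[OF xy] P_def[symmetric] using diag xy by (simp add: excess_def)
    with 2(3) show ?thesis by simp
  qed
  with w(2) show ?thesis
    unfolding t_def by blast
qed

text \<open>Exchanging both pairs of values swaps the diagonal cells and preserves the determinant
  condition, so either cell may be the smaller one. The inequalities kept in the conclusion later
  control \<open>excess\<close> when its denominator is 0.\<close>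

lemma achiever_peels_off:
  fixes J :: "(2 \<times> 'w \<times> 2) pmf"
  assumes xy: "x0 \<noteq> x1" "y0 \<noteq> y1"
    and ach: "achieves_common_entropy J"
  defines "P \<equiv> marg_XY J"
  assumes det: "pmf P (x1, y0) * pmf P (x0, y1) \<le> pmf P (x0, y0) * pmf P (x1, y1)"
  obtains w1 w2 where "set_pmf (marg_W J) \<subseteq> {w1, w2}"
    "peels_off J w1 x0 y0 (excess P x0 x1 y0 y1) \<and> pmf P (x0, y0) \<le> pmf P (x1, y1) \<or>
     peels_off J w1 x1 y1 (excess P x1 x0 y1 y0) \<and> pmf P (x1, y1) \<le> pmf P (x0, y0)"
proof (cases "pmf P (x0, y0) \<le> pmf P (x1, y1)")
  case True
  from achiever_peels_off_smaller[OF xy ach det[unfolded P_def] True[unfolded P_def]] that True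
  show ?thesis unfolding P_def by fastforce
next
  case False
  then have le: "pmf P (x1, y1) \<le> pmf P (x0, y0)" by simp
  have "pmf P (x0, y1) * pmf P (x1, y0) \<le> pmf P (x1, y1) * pmf P (x0, y0)"
    using det by (simp add: mult.commute)
  from achiever_peels_off_smaller[OF xy[symmetric] ach this[unfolded P_def] le[unfolded P_def]] that le
  show ?thesis unfolding P_def by fastforce
qed

section \<open>Matrix descriptions of an achieving W\<close>

text \<open>The four alternatives of the theorem are instances of one description. The label of the value
  of \<open>W\<close> that is a point mass on \<open>(x0, y0)\<close> is \<open>x0\<close>; \<open>\<gamma>\<close> and \<open>\<delta>\<close> are the conditional
  probabilities of \<open>Y = y0\<close> given \<open>X = x0\<close> and given the other value of \<open>X\<close>.\<close>

definition described :: "(2 \<times> 'w \<times> 2) pmf \<Rightarrow> 2 \<Rightarrow> 2 \<Rightarrow> real \<Rightarrow> real \<Rightarrow> bool" where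
  "described J x0 y0 \<gamma> \<delta> \<longleftrightarrow>
    (let c = (1 - \<gamma>) / (1 - \<delta>); q = pmf (marg_X J) x0 * (1 - c) in
       \<delta> < 1 \<and>
       W_described_by J
         (\<chi> y w. if w = x0 then of_bool (y = y0) else if y = y0 then \<delta> else 1 - \<delta>)
         (\<chi> w x. if x = x0 then if w = x0 then 1 - c else c else of_bool (w \<noteq> x0))
         (\<chi> w. if w = x0 then q else 1 - q))"

text \<open>One slice and the joint pmf of \<open>(X, Y)\<close> determine everything: all values
  other than \<open>w1\<close> share one label, whose slice is the removed mass \<open>q\<close> on
  the cell \<open>(x0, y0)\<close>. The matrices are then checked cell by cell.\<close>

lemma described_of_peels_off:
  fixes J :: "(2 \<times> 'w \<times> 2) pmf" and M :: "real ^ 2 ^ 2"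
  assumes xy: "x0 \<noteq> x1" "y0 \<noteq> y1"
    and M: "cond_matrix (marg_XY J) M"
    and \<gamma>: "M $ y0 $ x0 = \<gamma>" and \<delta>: "M $ y0 $ x1 = \<delta>"
    and "\<delta> \<le> \<gamma>" "\<delta> < 1"
    and c: "c = (1 - \<gamma>) / (1 - \<delta>)"
    and q: "q = pmf (marg_X J) x0 * (1 - c)"
    and supp: "set_pmf (marg_W J) \<subseteq> {w1, w2}"
    and peels: "peels_off J w1 x0 y0 q"
  shows "described J x0 y0 \<gamma> \<delta>"
proof -
  define P where "P = marg_XY J"
  define l where "l w = (if w = w1 then x1 else x0)" for w
  define K where "K = map_pmf (\<lambda>(x, w, y). (x, l w, y)) J"
  have PK: "marg_XY K = P" and XK: "marg_X K = marg_X J"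
    by (simp_all add: K_def P_def marg_XY_def marg_X_def pmf.map_comp comp_def case_prod_beta')
  have K1: "pmf K (x, x1, y) = pmf J (x, w1, y)" for x y
    unfolding K_def
    by (subst pmf_map_eq_sum[of "{(x, w1, y)}"]) (use xy in \<open>auto simp: l_def split: if_splits\<close>)
  have K1': "pmf K (x, x1, y) = pmf P (x, y) - (if x = x0 \<and> y = y0 then q else 0)" for x y
    using peels by (simp add: K1 peels_off_def P_def)
  have K0: "pmf K (x, x0, y) = (if x = x0 \<and> y = y0 then q else 0)" for x y
  proof -
    have "pmf P (x, y) = pmf K (x, x0, y) + pmf K (x, x1, y)"
      unfolding PK[symmetric] pmf_marg_XY by (rule sum_UNIV_2_eq[OF xy(1)])
    then show ?thesis by (simp add: K1')
  qed
  have M_nonneg: "0 \<le> M $ y $ x" and M_sum: "(\<Sum>y\<in>UNIV. M $ y $ x) = 1"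
    and M_P: "pmf P (x, y) = pmf (marg_X J) x * M $ y $ x" for x y
    using M unfolding cond_matrix_iff map_fst_marg P_def by blast+
  have M1: "M $ y1 $ x = 1 - M $ y0 $ x" for x
    using M_sum[of x] unfolding sum_UNIV_2_eq[OF xy(2)] by simp
  note P = M_P[of x0 y0, unfolded \<gamma>] M_P[of x0 y1, unfolded M1 \<gamma>]
    M_P[of x1 y0, unfolded \<delta>] M_P[of x1 y1, unfolded M1 \<delta>]
  have "(\<Sum>x\<in>UNIV. pmf (marg_X J) x) = 1"
    by (intro sum_pmf_eq_1) auto
  then have X1: "pmf (marg_X J) x1 = 1 - pmf (marg_X J) x0"
    unfolding sum_UNIV_2_eq[OF xy(1)] by simp
  have c01: "0 \<le> c" "c \<le> 1"
    using \<open>\<delta> \<le> \<gamma>\<close> \<open>\<delta> < 1\<close> M_nonneg[of y1 x0] by (auto simp: c M1 \<gamma>)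
  have cq: "c * (1 - \<delta>) = 1 - \<gamma>"
    using \<open>\<delta> < 1\<close> by (simp add: c)
  \<comment> \<open>Equivalent to \<open>P(Y = y0) - q = \<delta> * (1 - q)\<close>, that is,
    \<open>Y = y0\<close> has conditional probability \<open>\<delta>\<close> given the label
    \<open>x1\<close>.\<close>
  have q\<delta>: "q * (1 - \<delta>) = pmf (marg_X J) x0 * (\<gamma> - \<delta>)"
    unfolding q mult.assoc left_diff_distrib[of 1 c] cq by simp
  have \<delta>0: "0 \<le> \<delta>" using M_nonneg[of y0 x1] by (simp add: \<delta>)
  show ?thesis
    unfolding described_def Let_def c[symmetric] q[symmetric] W_described_by_def
  proof (intro exI[of _ l] conjI \<open>\<delta> < 1\<close>, unfold K_def[symmetric])
    show "inj_on l (set_pmf (marg_W J))"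
      using supp xy by (auto simp: inj_on_def l_def)
    have W0: "pmf (marg_W K) x0 = q"
      using xy by (simp add: pmf_marg_2[OF xy] K0)
    have W1: "pmf (marg_W K) x1 = 1 - q"
      using xy sum_pmf_2[OF xy, of P] by (simp add: pmf_marg_2[OF xy] K1')
    show "\<forall>i. pmf (marg_W K) i = (\<chi> w. if w = x0 then q else 1 - q) $ i"
      unfolding all_2_eq[OF xy(1)] using xy by (simp add: W0 W1)
    have sums: "(\<forall>a. (\<forall>b. 0 \<le> N $ b $ a) \<and> (\<Sum>b\<in>UNIV. N $ b $ a) = 1) \<longleftrightarrow>
        (\<forall>a b. 0 \<le> N $ b $ a) \<and> (\<forall>a. N $ z0 $ a + N $ z1 $ a = 1)"
      if "z0 \<noteq> z1" for N :: "real ^ 2 ^ 2" and z0 z1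
      unfolding sum_UNIV_2_eq[OF that] by blast
    show "cond_matrix (marg_WY K) (\<chi> y w. if w = x0 then of_bool (y = y0) else if y = y0 then \<delta> else 1 - \<delta>)"
      unfolding cond_matrix_iff map_fst_marg sums[OF xy(2)] all_2_2[OF xy] pmf_marg_2(2)[OF xy]
      using xy \<delta>0 \<open>\<delta> < 1\<close> q\<delta> by (simp add: all_2_eq[OF xy(1)] W0 W1 K0 K1' P X1 algebra_simps)
    show "cond_matrix (marg_XW K) (\<chi> w x. if x = x0 then if w = x0 then 1 - c else c else of_bool (w \<noteq> x0))"
      unfolding cond_matrix_iff map_fst_marg sums[OF xy(1)] all_2_2[OF xy(1) xy(1)] pmf_marg_2(1)[OF xy]
      using xy c01 q by (simp add: all_2_eq[OF xy(1)] XK K0 K1' P X1 algebra_simps)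
  qed
qed


text \<open>In general position \<open>excess\<close> equals the \<open>q\<close> of the
  description, from either diagonal cell. If a value of \<open>X\<close> is null or the two columns
  agree, the determinant is 0, nothing is removed and \<open>W\<close> is constant; a description
  with \<open>q = 0\<close> then applies.\<close>

lemma achiever_described:
  fixes J :: "(2 \<times> 'w \<times> 2) pmf" and M :: "real ^ 2 ^ 2"
  assumes xy: "x0 \<noteq> x1" "y0 \<noteq> y1"
    and ach: "achieves_common_entropy J"
    and M: "cond_matrix (marg_XY J) M"
    and \<gamma>: "M $ y0 $ x0 = \<gamma>" and \<delta>: "M $ y0 $ x1 = \<delta>" and "\<delta> \<le> \<gamma>"
  shows "described J x0 y0 \<gamma> \<delta> \<or> described J x1 y1 (1 - \<delta>) (1 - \<gamma>)"
proof -
  define P where "P = marg_XY J"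
  define p0 p1 where "p0 = pmf (marg_X J) x0" "p1 = pmf (marg_X J) x1"
  note p_def = p0_p1_def
  have M_nonneg: "0 \<le> M $ y $ x" and M_sum: "(\<Sum>y\<in>UNIV. M $ y $ x) = 1"
    and M_P: "pmf P (x, y) = pmf (marg_X J) x * M $ y $ x" for x y
    using M unfolding cond_matrix_iff map_fst_marg P_def by blast+
  have M1: "M $ y1 $ x = 1 - M $ y0 $ x" for x
    using M_sum[of x] unfolding sum_UNIV_2_eq[OF xy(2)] by simp
  have \<gamma>': "M $ y1 $ x0 = 1 - \<gamma>" and \<delta>': "M $ y1 $ x1 = 1 - \<delta>"
    by (simp_all add: M1 \<gamma> \<delta>)
  have P: "pmf P (x0, y0) = p0 * \<gamma>" "pmf P (x0, y1) = p0 * (1 - \<gamma>)"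
    "pmf P (x1, y0) = p1 * \<delta>" "pmf P (x1, y1) = p1 * (1 - \<delta>)"
    by (simp_all add: M_P \<gamma> \<delta> M1 p_def)
  have p: "0 \<le> p0" "0 \<le> p1" by (simp_all add: p_def)
  have range: "0 \<le> \<delta>" "\<gamma> \<le> 1"
    using M_nonneg[of y0 x1] M_nonneg[of y1 x0] by (simp_all add: \<delta> \<gamma>')
  have det_eq: "pmf P (x0, y0) * pmf P (x1, y1) - pmf P (x1, y0) * pmf P (x0, y1) = p0 * p1 * (\<gamma> - \<delta>)"
    by (simp add: P algebra_simps)
  have "0 \<le> p0 * p1 * (\<gamma> - \<delta>)"
    using p \<open>\<delta> \<le> \<gamma>\<close> by simp
  then have "pmf P (x1, y0) * pmf P (x0, y1) \<le> pmf P (x0, y0) * pmf P (x1, y1)"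
    using det_eq by linarith
  from achiever_peels_off[OF xy ach this[unfolded P_def], folded P_def]
  obtain w1 w2 where supp: "set_pmf (marg_W J) \<subseteq> {w1, w2}" and peels:
    "peels_off J w1 x0 y0 (excess P x0 x1 y0 y1) \<and> pmf P (x0, y0) \<le> pmf P (x1, y1) \<or>
     peels_off J w1 x1 y1 (excess P x1 x0 y1 y0) \<and> pmf P (x1, y1) \<le> pmf P (x0, y0)"
    by blast
  note left = described_of_peels_off[OF xy M \<gamma> \<delta> \<open>\<delta> \<le> \<gamma>\<close> _ refl _ supp]
  \<comment> \<open>The mirror image under exchange of both pairs of values, where the ratio
    \<open>c\<close> becomes \<open>\<delta> / \<gamma>\<close>.\<close>
  have right: "described J x1 y1 (1 - \<delta>) (1 - \<gamma>)"
    if "0 < \<gamma>" "q = p1 * (1 - \<delta> / \<gamma>)" "peels_off J w1 x1 y1 q" for q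
    using that \<open>\<delta> \<le> \<gamma>\<close>
    by (intro described_of_peels_off[OF xy[symmetric] M \<delta>' \<gamma>' _ _ refl _ supp, of q]) (auto simp: p_def)
  show ?thesis
  proof (cases "p0 = 0 \<or> p1 = 0 \<or> \<gamma> = \<delta>")
    case False
    then have pos: "0 < p0" "0 < p1" "\<delta> < \<gamma>" "\<delta> < 1" "0 < \<gamma>"
      using p \<open>\<delta> \<le> \<gamma>\<close> range by auto
    have "excess P x0 x1 y0 y1 = p0 * (1 - (1 - \<gamma>) / (1 - \<delta>))"
      using pos by (simp add: excess_def P field_simps)
    moreover have "excess P x1 x0 y1 y0 = p1 * (1 - \<delta> / \<gamma>)"
      using pos by (simp add: excess_def P field_simps)
    ultimately show ?thesis
      using peels left[OF \<open>\<delta> < 1\<close>] right[OF \<open>0 < \<gamma>\<close>] by (auto simp: p_def)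
  next
    case True
    then have det0: "pmf P (x0, y0) * pmf P (x1, y1) = pmf P (x1, y0) * pmf P (x0, y1)"
      using det_eq by auto
    have "excess P x0 x1 y0 y1 = 0" if "pmf P (x0, y0) \<le> pmf P (x1, y1)"
      using that by (cases "pmf P (x1, y1) = 0") (auto simp: excess_def det0[symmetric])
    moreover have "excess P x1 x0 y1 y0 = 0" if "pmf P (x1, y1) \<le> pmf P (x0, y0)"
      using that det0 by (cases "pmf P (x0, y0) = 0") (auto simp: excess_def field_simps)
    \<comment> \<open>Removing mass 0 leaves the slice equal to the full joint pmf, so the cell may
      be chosen freely.\<close>
    ultimately have peels0: "peels_off J w1 x y 0" for x y
      using peels by (auto simp: peels_off_def)
    \<comment> \<open>The choice keeps the denominator positive: \<open>\<delta> = 1\<close> forces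
      \<open>\<gamma> = \<delta>\<close> and the second case, \<open>\<gamma> = 0\<close> forces
      \<open>\<gamma> = \<delta>\<close> and the first.\<close>
    consider "\<delta> < 1" "p0 = 0 \<or> \<gamma> = \<delta>" | "0 < \<gamma>" "p1 = 0 \<or> \<gamma> = \<delta>"
      using True \<open>\<delta> \<le> \<gamma>\<close> range by fastforce
    then show ?thesis
    proof cases
      case 1
      then show ?thesis using left[OF _ _ peels0] by (auto simp: p_def)
    next
      case 2
      then show ?thesis using right[OF _ _ peels0] by auto
    qed
  qed
qed

section \<open>The explicit matrix alternatives\<close>

lemma vec_lambda_2: "(\<chi> i. f i) = (vector [f 1, f 2] :: 'a::zero ^ 2)"
  by (simp add: vec_eq_iff forall_2)

text \<open>The sign of the determinant decides which diagonal loses mass. The two alternatives for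
  \<open>\<beta> \<le> \<alpha>\<close> are those for \<open>\<alpha> \<le> \<beta>\<close> with the
  values of \<open>Y\<close> exchanged. The strict inequalities guarantee that the quotients
  \<open>c\<close> are genuine.\<close>

theorem proposition8:
  fixes J :: "(2 \<times> 'w \<times> 2) pmf" and p \<alpha> \<beta> :: real
  assumes "0 \<le> \<alpha>" "\<alpha> \<le> 1" and "0 \<le> \<beta>" "\<beta> \<le> 1"
    and "pmf (marg_X J) 1 = p" and "pmf (marg_X J) 2 = 1 - p"
    and "cond_matrix (marg_XY J) (vector [vector [\<alpha>, \<beta>], vector [1 - \<alpha>, 1 - \<beta>]])"
    and "achieves_common_entropy J"
  shows "(\<alpha> \<le> \<beta> \<longrightarrow>
      (let c = (1 - \<beta>) / (1 - \<alpha>); q = (1 - p) * (1 - c) in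
         \<alpha> < 1 \<and>
         W_described_by J
           (vector [vector [\<alpha>, 1], vector [1 - \<alpha>, 0]])
           (vector [vector [1, c], vector [0, 1 - c]])
           (vector [1 - q, q])) \<or>
      (let c = \<alpha> / \<beta>; q = p * (1 - c) in
         0 < \<beta> \<and>
         W_described_by J
           (vector [vector [0, \<beta>], vector [1, 1 - \<beta>]])
           (vector [vector [1 - c, 0], vector [c, 1]])
           (vector [q, 1 - q])))
    \<and> (\<beta> \<le> \<alpha> \<longrightarrow>
      (let c = \<beta> / \<alpha>; q = (1 - p) * (1 - c) in
         0 < \<alpha> \<and>
         W_described_by J
           (vector [vector [\<alpha>, 0], vector [1 - \<alpha>, 1]])
           (vector [vector [1, c], vector [0, 1 - c]])
           (vector [1 - q, q])) \<or>
      (let c = (1 - \<alpha>) / (1 - \<beta>); q = p * (1 - c) in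
         \<beta> < 1 \<and>
         W_described_by J
           (vector [vector [1, \<beta>], vector [0, 1 - \<beta>]])
           (vector [vector [1 - c, 0], vector [c, 1]])
           (vector [q, 1 - q])))"
proof -
  let ?M = "vector [vector [\<alpha>, \<beta>], vector [1 - \<alpha>, 1 - \<beta>]] :: real ^ 2 ^ 2"
  have ne: "(2 :: 2) \<noteq> 1" "(1 :: 2) \<noteq> 2"
    by simp_all
  have M: "?M $ 1 $ 1 = \<alpha>" "?M $ 1 $ 2 = \<beta>" "?M $ 2 $ 1 = 1 - \<alpha>" "?M $ 2 $ 2 = 1 - \<beta>"
    by simp_all
  note descr = described_def vec_lambda_2 assms(5,6) Let_def
  show ?thesis
  proof (intro conjI impI)
    assume "\<alpha> \<le> \<beta>"
    \<comment> \<open>The diagonal with the larger product consists of the cells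
      \<open>(2, 1)\<close> and \<open>(1, 2)\<close>.\<close>
    with achiever_described[OF ne assms(8,7) M(2,1)]
    have "described J 2 1 \<beta> \<alpha> \<or> described J 1 2 (1 - \<alpha>) (1 - \<beta>)"
      by blast
    then show "(let c = (1 - \<beta>) / (1 - \<alpha>); q = (1 - p) * (1 - c) in
         \<alpha> < 1 \<and>
         W_described_by J
           (vector [vector [\<alpha>, 1], vector [1 - \<alpha>, 0]])
           (vector [vector [1, c], vector [0, 1 - c]])
           (vector [1 - q, q])) \<or>
      (let c = \<alpha> / \<beta>; q = p * (1 - c) in
         0 < \<beta> \<and>
         W_described_by J
           (vector [vector [0, \<beta>], vector [1, 1 - \<beta>]])
           (vector [vector [1 - c, 0], vector [c, 1]])
           (vector [q, 1 - q]))"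
      by (simp add: descr)
  next
    assume "\<beta> \<le> \<alpha>"
    \<comment> \<open>Now the diagonal consists of \<open>(2, 2)\<close> and \<open>(1, 1)\<close>,
      with conditional probabilities read off the second row.\<close>
    with achiever_described[OF ne(1) ne(1) assms(8,7) M(4,3)]
    have "described J 2 2 (1 - \<beta>) (1 - \<alpha>) \<or> described J 1 1 \<alpha> \<beta>"
      by simp
    then show "(let c = \<beta> / \<alpha>; q = (1 - p) * (1 - c) in
         0 < \<alpha> \<and>
         W_described_by J
           (vector [vector [\<alpha>, 0], vector [1 - \<alpha>, 1]])
           (vector [vector [1, c], vector [0, 1 - c]])
           (vector [1 - q, q])) \<or>
      (let c = (1 - \<alpha>) / (1 - \<beta>); q = p * (1 - c) in
         \<beta> < 1 \<and>
         W_described_by J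
           (vector [vector [1, \<beta>], vector [0, 1 - \<beta>]])
           (vector [vector [1 - c, 0], vector [c, 1]])
           (vector [q, 1 - q]))"
      by (simp add: descr)
  qed
qed

end
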